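(* Suppose that all the functions $\varphi_\nu$ ($\nu\in\mathbb{N}$) of the family $\varPhi$ are convex. Then $G(\mathcal{H})=GS(\varPhi^* )$ (equality of the spaces with their topologies).
   Context: Notation: $n\in\mathbb{N}$ is fixed, $\|\cdot\|$ is the Euclidean norm, $\langle u,v\rangle=u_1v_1+\cdots+u_nv_n$; for multi-indices $\alpha\in\mathbb{Z}_+^n$: $|\alpha|=\alpha_1+\cdots+\alpha_n$, $\alpha!=\alpha_1!\cdots\alpha_n!$, $x^\alpha=x_1^{\alpha_1}\cdots x_n^{\alpha_n}$, $D^\alpha=\partial^{|\alpha|}/\partial x_1^{\alpha_1}\cdots\partial x_n^{\alpha_n}$. For $g\colon\mathbb{R}^n\to[-\infty,+\infty]$, $g^*(x)=\sup_{y\in\mathbb{R}^n}(\langle x,y\rangle-g(y))$. $\mathcal{H}=\{h_\nu\}_{\nu=1}^\infty$ is a fixed family of convex functions $h_\nu\colon\mathbb{R}^n\to\mathbb{R}$ such that for each $\nu\in\mathbb{N}$: 1) $h_\nu(x)=h_\nu(|x_1|,\ldots,|x_n|)$ for $x\in\mathbb{R}^n$; 2) the restriction of $h_\nu$ to $[0,\infty)^n$ is nondecreasing in each variable; 3) $\lim_{x\to\infty} h_\nu(x)/\|x\|=+\infty$; 4) for each $M>0$ there exists a constant $A_{\nu,M}>0$ such that $h_\nu(x)\le\sum_{1\le j\le n:\,x_j\ne0}x_j\ln\frac{x_j}{M}+A_{\nu,M}$ for $x\in[0,\infty)^n$; 5) there is a constant $\gamma_\nu$ with $h_\nu(x)-h_{\nu+1}(x)\ge\ln2\cdot\sum_{j=1}^n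 x_j-\gamma_\nu$ for $x\in[0,\infty)^n$; 6) there is a constant $l_\nu$ with $h_{\nu+1}(x+y)\le h_\nu(x)+h_\nu(y)+l_\nu$ for $x,y\in[0,\infty)^n$. For $\nu\in\mathbb{N}$, $m\in\mathbb{Z}_+$, let $$G_m(h_\nu)=\Big\{f\in C^m(\mathbb{R}^n):\ \|f\|_{m,h_\nu}=\sup_{x\in\mathbb{R}^n,\ \beta\in\mathbb{Z}_+^n,\ |\alpha|\le m}\frac{|x^\beta(D^\alpha f)(x)|}{\beta!\,e^{-h_\nu(\beta)}}<\infty\Big\},$$ $G(h_\nu)=\bigcap_{m\ge0}G_m(h_\nu)$ with the topology defined by the norms $\|\cdot\|_{m,h_\nu}$ ($m\in\mathbb{Z}_+$), and $G(\mathcal{H})=\bigcup_{\nu\ge1}G(h_\nu)$ with the inductive limit topology of the spaces $G(h_\nu)$. For $\nu\in\mathbb{N}$ let $\varphi_\nu(x)=h_\nu^*(\ln(1+|x_1|),\ldots,\ln(1+|x_n|))$, $x\in\mathbb{R}^n$; $\varPhi=\{\varphi_\nu\}_{\nu=1}^\infty$ and $\varPhi^*=\{\varphi_\nu^*\}_{\nu=1}^\infty$, where $\varphi_\nu^*$ is the Young–Fenchel conjugate of $\varphi_\nu$ (finite on $\mathbb{R}^n$, since $\varphi_\nu(x)/\|x\|\to+\infty$ as $x\to\infty$). For a family $\mathcal{M}=\{M_\nu\}_{\nu=1}^\infty$ of functions $M_\nu\colon\mathbb{R}^n\to\mathbb{R}$ (here $M_\nu=\varphi_\nu^*$) and $m\in\mathbb{Z}_+$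 let $$GS_m(M_\nu)=\Big\{f\in C^m(\mathbb{R}^n):\ q_{m,\nu}(f)=\sup_{x\in\mathbb{R}^n,\ |\alpha|\le m}\frac{|(D^\alpha f)(x)|}{e^{-M_\nu(x)}}<\infty\Big\},$$ $GS(M_\nu)=\bigcap_{m\ge0}GS_m(M_\nu)$ with the topology defined by the norms $q_{m,\nu}$ ($m\in\mathbb{Z}_+$), and $GS(\mathcal{M})=\bigcup_{\nu\ge1}GS(M_\nu)$ with the inductive limit topology of the spaces $GS(M_\nu)$. Inductive limits are taken in the locally convex sense. *)

theory Defs
  imports "HOL-Analysis.Analysis"
begin

text \<open>
  A multi-index in \<open>\<int>\<^sub>+\<^sup>n\<close> is a function \<open>'n \<Rightarrow> nat\<close>, where \<open>n = CARD('n)\<close>. Families \<open>{h\<^sub>\<nu>}\<close>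
  with \<open>\<nu> = 1, 2, \<dots>\<close> are functions on \<open>nat\<close> of which only the members with \<open>\<nu> \<ge> 1\<close> are used.
\<close>

definition mi_abs :: "('n::finite \<Rightarrow> nat) \<Rightarrow> nat"
  where "mi_abs \<alpha> = (\<Sum>j\<in>UNIV. \<alpha> j)"

definition mi_fact :: "('n::finite \<Rightarrow> nat) \<Rightarrow> real"
  where "mi_fact \<alpha> = (\<Prod>j\<in>UNIV. fact (\<alpha> j))"

definition mi_power :: "real ^ 'n \<Rightarrow> ('n::finite \<Rightarrow> nat) \<Rightarrow> real"
  where "mi_power x \<alpha> = (\<Prod>j\<in>UNIV. (x $ j) ^ \<alpha> j)"

definition mi_vec :: "('n::finite \<Rightarrow> nat) \<Rightarrow> real ^ 'n"
  where "mi_vec \<alpha> = (\<chi> j. real (\<alpha> j))"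


subsection \<open>Partial derivatives and continuously differentiable functions\<close>

definition partial_deriv :: "'n::finite \<Rightarrow> (real ^ 'n \<Rightarrow> complex) \<Rightarrow> real ^ 'n \<Rightarrow> complex"
  where "partial_deriv j f x = vector_derivative (\<lambda>t. f (x + t *\<^sub>R axis j 1)) (at 0)"

definition has_partial_derivs :: "(real ^ 'n::finite \<Rightarrow> complex) \<Rightarrow> bool"
  where "has_partial_derivs f \<longleftrightarrow>
    (\<forall>j x. (\<lambda>t. f (x + t *\<^sub>R axis j 1)) differentiable (at 0))"

text \<open>\<open>Cm m\<close> is \<open>C\<^sup>m(\<real>\<^sup>n)\<close>: all iterated partial derivatives of order at most \<open>m\<close>, taken in any
  order of the variables, exist and are continuous.\<close>

primrec Cm :: "nat \<Rightarrow> (real ^ 'n::finite \<Rightarrow> complex) set" where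
  "Cm 0 = {f. continuous_on UNIV f}"
| "Cm (Suc m) = {f. continuous_on UNIV f \<and> has_partial_derivs f \<and> (\<forall>j. partial_deriv j f \<in> Cm m)}"

text \<open>A finite index type carries no order, so an enumeration \<open>x\<^sub>1, \<dots>, x\<^sub>n\<close> of the coordinates is fixed
  once and for all. It determines the order of differentiation in \<open>D\<^sup>\<alpha>\<close>, which is
  immaterial for \<open>f \<in> Cm m\<close> and \<open>mi_abs \<alpha> \<le> m\<close>.\<close>

definition coords :: "'n::finite list"
  where "coords = (SOME js. distinct js \<and> set js = UNIV)"

definition mi_deriv :: "('n::finite \<Rightarrow> nat) \<Rightarrow> (real ^ 'n \<Rightarrow> complex) \<Rightarrow> real ^ 'n \<Rightarrow> complex"
  where "mi_deriv \<alpha> f = foldr (\<lambda>j. partial_deriv j ^^ \<alpha> j) coords f"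

lemma coords: "distinct (coords :: 'n::finite list)" "set (coords :: 'n list) = UNIV"
proof -
  have "\<exists>js :: 'n list. distinct js \<and> set js = UNIV"
    using finite_distinct_list[OF finite[of "UNIV :: 'n set"]] by blast
  from someI_ex[OF this] show "distinct (coords :: 'n list)" "set (coords :: 'n list) = UNIV"
    unfolding coords_def by auto
qed


subsection \<open>The Young--Fenchel conjugate\<close>

definition YF_conj :: "(real ^ 'n::finite \<Rightarrow> ereal) \<Rightarrow> real ^ 'n \<Rightarrow> ereal"
  where "YF_conj g x = (SUP y. ereal (x \<bullet> y) - g y)"

text \<open>For real-valued functions with a finite conjugate, the conjugate as a real-valued function.
  It is used only where the conjugate is finite; see the lemmas \<open>YF_conj_weight_finite\<close> and
  \<open>YF_conj_phi_finite\<close> at the end of the theory.\<close>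

definition conj_fun :: "(real ^ 'n::finite \<Rightarrow> real) \<Rightarrow> real ^ 'n \<Rightarrow> real"
  where "conj_fun g x = real_of_ereal (YF_conj (\<lambda>y. ereal (g y)) x)"

definition phi :: "(real ^ 'n::finite \<Rightarrow> real) \<Rightarrow> real ^ 'n \<Rightarrow> real"
  where "phi h x = conj_fun h (\<chi> j. ln (1 + \<bar>x $ j\<bar>))"


subsection \<open>Locally convex topologies on spaces of functions\<close>

text \<open>The topology on \<open>V\<close> defined by (semi)norms \<open>p 0, p 1, \<dots>\<close>, which are finite on the linear space
  \<open>V\<close>: the balls form a subbase.\<close>

definition norms_topology ::
    "('a \<Rightarrow> complex) set \<Rightarrow> (nat \<Rightarrow> ('a \<Rightarrow> complex) \<Rightarrow> ereal) \<Rightarrow> ('a \<Rightarrow> complex) topology"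
  where "norms_topology V p = topology_generated_by
    {{g \<in> V. p m (\<lambda>x. g x - f x) < ereal \<epsilon>} | f m \<epsilon>. f \<in> V \<and> \<epsilon> > 0}"

definition locally_convex_topology :: "('a \<Rightarrow> complex) topology \<Rightarrow> bool"
  where "locally_convex_topology T \<longleftrightarrow>
    continuous_map (prod_topology T T) T (\<lambda>(f, g). \<lambda>x. f x + g x) \<and>
    continuous_map (prod_topology euclidean T) T (\<lambda>(c, f). \<lambda>x. c * f x) \<and>
    (\<forall>U. openin T U \<and> (\<lambda>x. 0) \<in> U \<longrightarrow>
      (\<exists>W. openin T W \<and> (\<lambda>x. 0) \<in> W \<and> W \<subseteq> U \<and>
        (\<forall>f\<in>W. \<forall>g\<in>W. \<forall>t\<in>{0..1::real}.
          (\<lambda>x. (1 - t) *\<^sub>R f x + t *\<^sub>R g x) \<in> W)))"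

definition lc_admissible ::
    "'i set \<Rightarrow> ('i \<Rightarrow> ('a \<Rightarrow> complex) topology) \<Rightarrow> ('a \<Rightarrow> complex) topology \<Rightarrow> bool"
  where "lc_admissible I E T \<longleftrightarrow>
    locally_convex_topology T \<and> topspace T = (\<Union>i\<in>I. topspace (E i)) \<and>
    (\<forall>i\<in>I. continuous_map (E i) T id)"

text \<open>The locally convex inductive limit of the spaces \<open>E i\<close>: the finest locally convex topology
  on their union for which all inclusions are continuous, obtained as the supremum of all such
  topologies (see \<open>lc_inductive_limit_admissible\<close> and \<open>lc_inductive_limit_finest\<close>).\<close>

definition lc_inductive_limit ::
    "'i set \<Rightarrow> ('i \<Rightarrow> ('a \<Rightarrow> complex) topology) \<Rightarrow> ('a \<Rightarrow> complex) topology"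
  where "lc_inductive_limit I E = topology_generated_by {U. \<exists>T. lc_admissible I E T \<and> openin T U}"


subsection \<open>The spaces \<open>G(\<H>)\<close>\<close>

definition G_norm ::
    "(real ^ 'n::finite \<Rightarrow> real) \<Rightarrow> nat \<Rightarrow> (real ^ 'n \<Rightarrow> complex) \<Rightarrow> ereal"
  where "G_norm h m f =
    (SUP (x, \<beta>, \<alpha>) \<in> UNIV \<times> UNIV \<times> {\<alpha>. mi_abs \<alpha> \<le> m}.
      ereal (cmod (complex_of_real (mi_power x \<beta>) * mi_deriv \<alpha> f x)
        / (mi_fact \<beta> * exp (- h (mi_vec \<beta>)))))"

definition G_m :: "(real ^ 'n::finite \<Rightarrow> real) \<Rightarrow> nat \<Rightarrow> (real ^ 'n \<Rightarrow> complex) set"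
  where "G_m h m = {f \<in> Cm m. G_norm h m f < \<infinity>}"

definition G_space :: "(real ^ 'n::finite \<Rightarrow> real) \<Rightarrow> (real ^ 'n \<Rightarrow> complex) set"
  where "G_space h = (\<Inter>m. G_m h m)"

definition G_top :: "(real ^ 'n::finite \<Rightarrow> real) \<Rightarrow> (real ^ 'n \<Rightarrow> complex) topology"
  where "G_top h = norms_topology (G_space h) (G_norm h)"

definition G_lim :: "(nat \<Rightarrow> real ^ 'n::finite \<Rightarrow> real) \<Rightarrow> (real ^ 'n \<Rightarrow> complex) set"
  where "G_lim h = (\<Union>\<nu>\<in>{1..}. G_space (h \<nu>))"

definition G_lim_top :: "(nat \<Rightarrow> real ^ 'n::finite \<Rightarrow> real) \<Rightarrow> (real ^ 'n \<Rightarrow> complex) topology"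
  where "G_lim_top h = lc_inductive_limit {1..} (\<lambda>\<nu>. G_top (h \<nu>))"


subsection \<open>The spaces \<open>GS(\<M>)\<close>\<close>

definition GS_norm ::
    "(real ^ 'n::finite \<Rightarrow> real) \<Rightarrow> nat \<Rightarrow> (real ^ 'n \<Rightarrow> complex) \<Rightarrow> ereal"
  where "GS_norm M m f =
    (SUP (x, \<alpha>) \<in> UNIV \<times> {\<alpha>. mi_abs \<alpha> \<le> m}. ereal (cmod (mi_deriv \<alpha> f x) / exp (- M x)))"

definition GS_m :: "(real ^ 'n::finite \<Rightarrow> real) \<Rightarrow> nat \<Rightarrow> (real ^ 'n \<Rightarrow> complex) set"
  where "GS_m M m = {f \<in> Cm m. GS_norm M m f < \<infinity>}"

definition GS_space :: "(real ^ 'n::finite \<Rightarrow> real) \<Rightarrow> (real ^ 'n \<Rightarrow> complex) set"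
  where "GS_space M = (\<Inter>m. GS_m M m)"

definition GS_top :: "(real ^ 'n::finite \<Rightarrow> real) \<Rightarrow> (real ^ 'n \<Rightarrow> complex) topology"
  where "GS_top M = norms_topology (GS_space M) (GS_norm M)"

definition GS_lim :: "(nat \<Rightarrow> real ^ 'n::finite \<Rightarrow> real) \<Rightarrow> (real ^ 'n \<Rightarrow> complex) set"
  where "GS_lim M = (\<Union>\<nu>\<in>{1..}. GS_space (M \<nu>))"

definition GS_lim_top :: "(nat \<Rightarrow> real ^ 'n::finite \<Rightarrow> real) \<Rightarrow> (real ^ 'n \<Rightarrow> complex) topology"
  where "GS_lim_top M = lc_inductive_limit {1..} (\<lambda>\<nu>. GS_top (M \<nu>))"


subsection \<open>Properties of the inductive limit topology\<close>

lemma lc_inductive_limit_finest: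
  "lc_admissible I E T \<Longrightarrow> openin T U \<Longrightarrow> openin (lc_inductive_limit I E) U"
  unfolding lc_inductive_limit_def by (intro topology_generated_by_Basis) blast

lemma lc_inductive_limit_admissible:
  fixes I :: "'i set" and E :: "'i \<Rightarrow> ('a \<Rightarrow> complex) topology"
  defines "V \<equiv> (\<Union>i\<in>I. topspace (E i))"
  assumes zero: "(\<lambda>x. 0) \<in> V"
    and add: "\<And>f g. f \<in> V \<Longrightarrow> g \<in> V \<Longrightarrow> (\<lambda>x. f x + g x) \<in> V"
    and scale: "\<And>c f. f \<in> V \<Longrightarrow> (\<lambda>x. c * f x) \<in> V"
  shows "lc_admissible I E (lc_inductive_limit I E)"
proof -
  let ?L = "lc_inductive_limit I E"
  let ?B = "{U. \<exists>T. lc_admissible I E T \<and> openin T U}"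
  let ?cv = "\<lambda>W. \<forall>f\<in>W. \<forall>g\<in>W. \<forall>t\<in>{0..1::real}. (\<lambda>x. (1 - t) *\<^sub>R f x + t *\<^sub>R g x) \<in> W"
  have cvV: "?cv V"
    using add scale by (auto simp: scaleR_conv_of_real simp del: of_real_diff)
  define T0 where "T0 = pullback_topology V (\<lambda>_. 0 :: real) euclidean"
  have T0: "openin T0 U \<longleftrightarrow> U = {} \<or> U = V" for U
  proof
    assume "openin T0 U"
    then obtain U' where "U = (\<lambda>_. 0 :: real) -` U' \<inter> V"
      unfolding T0_def openin_pullback_topology by blast
    then show "U = {} \<or> U = V" by (cases "0 \<in> U'") auto
  next
    assume "U = {} \<or> U = V"
    then have "U = (\<lambda>_. 0 :: real) -` {} \<inter> V \<or> U = (\<lambda>_. 0 :: real) -` UNIV \<inter> V" by auto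
    moreover have "openin euclidean ({} :: real set)" "openin euclidean (UNIV :: real set)" by auto
    ultimately show "openin T0 U"
      unfolding T0_def openin_pullback_topology by blast
  qed
  have top0: "topspace T0 = V" unfolding topspace_def using T0 by blast
  have cm0: "continuous_map X T0 f" if "f ` topspace X \<subseteq> V" for X :: "'b topology" and f
  proof -
    have "{x \<in> topspace X. f x \<in> V} = topspace X" using that by auto
    then show ?thesis using that by (auto simp: continuous_map_def T0 top0)
  qed
  have adm0: "lc_admissible I E T0"
    unfolding lc_admissible_def locally_convex_topology_def
  proof (intro conjI ballI allI impI)
    show "continuous_map (prod_topology T0 T0) T0 (\<lambda>(f, g). \<lambda>x. f x + g x)"
      using add by (intro cm0) (auto simp: top0)
    show "continuous_map (prod_topology euclidean T0) T0 (\<lambda>(c, f). \<lambda>x. c * f x)"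
      using scale by (intro cm0) (auto simp: top0)
    show "topspace T0 = (\<Union>i\<in>I. topspace (E i))" by (simp add: top0 V_def)
    show "continuous_map (E i) T0 id" if "i \<in> I" for i
      using that by (intro cm0) (auto simp: V_def)
    show "\<exists>W. openin T0 W \<and> (\<lambda>x. 0) \<in> W \<and> W \<subseteq> U \<and> ?cv W"
      if "openin T0 U \<and> (\<lambda>x. 0) \<in> U" for U
    proof (intro exI[of _ V] conjI)
      show "openin T0 V" "V \<subseteq> U" using that T0 by auto
    qed (fact zero cvV)+
  qed
  have subV: "U \<subseteq> V" if "lc_admissible I E T" "openin T U" for T U
    using openin_subset[OF that(2)] that(1) by (simp add: lc_admissible_def V_def)
  have "openin T0 V" by (simp add: T0)
  with adm0 have V_B: "V \<in> ?B" by blast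
  have topL: "topspace ?L = V"
    unfolding lc_inductive_limit_def topology_generated_by_topspace
  proof
    show "\<Union>?B \<subseteq> V" using subV by (intro Union_least) blast
    show "V \<subseteq> \<Union>?B" using V_B by (rule Union_upper)
  qed
  have topT: "topspace T = V" if "lc_admissible I E T" for T
    using that by (simp add: lc_admissible_def V_def)
  have into_L: "continuous_map X ?L f"
    if "\<And>T. lc_admissible I E T \<Longrightarrow> continuous_map X T f" for X :: "'b topology" and f
    unfolding lc_inductive_limit_def
  proof (rule continuous_on_generated_topo)
    fix U assume "U \<in> ?B"
    then obtain T where T: "lc_admissible I E T" "openin T U" by blast
    then have "openin X {x \<in> topspace X. f x \<in> U}"
      using that[OF T(1)] unfolding continuous_map_def by (elim conjE allE impE)
    moreover have "{x \<in> topspace X. f x \<in> U} = f -` U \<inter> topspace X" by auto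
    ultimately show "openin X (f -` U \<inter> topspace X)" by simp
  next
    have "f ` topspace X \<subseteq> V"
      using that[OF adm0] by (auto simp: continuous_map_def top0)
    also have "V \<subseteq> \<Union>?B" using V_B by (rule Union_upper)
    finally show "f ` topspace X \<subseteq> \<Union>?B" .
  qed
  have idL: "continuous_map ?L T id" if "lc_admissible I E T" for T
    unfolding continuous_map_def
  proof (intro conjI allI impI)
    show "id \<in> topspace ?L \<rightarrow> topspace T" using topL topT[OF that] by auto
    fix U assume U: "openin T U"
    then have "openin ?L U" using that by (rule lc_inductive_limit_finest[rotated])
    moreover have "{x \<in> topspace ?L. id x \<in> U} = U" using topL subV[OF that U] by auto
    ultimately show "openin ?L {x \<in> topspace ?L. id x \<in> U}" by simp
  qed
  have convex_base: "\<exists>W. openin ?L W \<and> (\<lambda>x. 0) \<in> W \<and> W \<subseteq> U \<and> ?cv W"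
    if "openin ?L U" "(\<lambda>x. 0) \<in> U" for U
  proof -
    define cv where "cv = (\<lambda>W :: ('a \<Rightarrow> complex) set. ?cv W)"
    have cv_Int: "cv (A \<inter> B)" if "cv A" "cv B" for A B
      using that unfolding cv_def by simp
    have "generate_topology_on ?B U"
      using that(1) unfolding lc_inductive_limit_def by (rule openin_topology_generated_by)
    then have "(\<lambda>x. 0) \<in> U \<longrightarrow> (\<exists>W. openin ?L W \<and> (\<lambda>x. 0) \<in> W \<and> W \<subseteq> U \<and> cv W)"
    proof (induction rule: generate_topology_on.induct)
      case Empty
      show ?case by simp
    next
      case (Int a b)
      show ?case
      proof
        assume "(\<lambda>x. 0) \<in> a \<inter> b"
        then obtain W1 W2 where
          W: "openin ?L W1" "(\<lambda>x. 0) \<in> W1" "W1 \<subseteq> a" "cv W1"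
            "openin ?L W2" "(\<lambda>x. 0) \<in> W2" "W2 \<subseteq> b" "cv W2"
          using Int.IH by fast
        show "\<exists>W. openin ?L W \<and> (\<lambda>x. 0) \<in> W \<and> W \<subseteq> a \<inter> b \<and> cv W"
        proof (intro exI conjI)
          show "openin ?L (W1 \<inter> W2)" using W by (intro openin_Int)
          show "cv (W1 \<inter> W2)" using W by (intro cv_Int)
        qed (use W in auto)
      qed
    next
      case (UN K)
      show ?case
      proof
        assume "(\<lambda>x. 0) \<in> \<Union>K"
        then obtain k where k: "k \<in> K" "(\<lambda>x. 0) \<in> k" by (rule UnionE)
        with UN.IH[OF k(1)] obtain W where
          W: "openin ?L W" "(\<lambda>x. 0) \<in> W" "W \<subseteq> k" "cv W" by fast
        moreover have "W \<subseteq> \<Union>K" using W(3) k(1) by (meson Union_upper subset_trans)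
        ultimately show "\<exists>W. openin ?L W \<and> (\<lambda>x. 0) \<in> W \<and> W \<subseteq> \<Union>K \<and> cv W" by fast
      qed
    next
      case (Basis s)
      then obtain T where T: "lc_admissible I E T" "openin T s" by (elim CollectE exE conjE)
      have "\<forall>U. openin T U \<and> (\<lambda>x. 0) \<in> U \<longrightarrow>
          (\<exists>W. openin T W \<and> (\<lambda>x. 0) \<in> W \<and> W \<subseteq> U \<and> cv W)"
        using T(1) unfolding lc_admissible_def locally_convex_topology_def cv_def
        by (elim conjE)
      then show ?case using T(2) lc_inductive_limit_finest[OF T(1)] by fast
    qed
    then show ?thesis using that(2) unfolding cv_def by (rule mp)
  qed
  show ?thesis
    unfolding lc_admissible_def locally_convex_topology_def
  proof (intro conjI ballI allI impI)
    show "continuous_map (prod_topology ?L ?L) ?L (\<lambda>(f, g). \<lambda>x. f x + g x)"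
    proof (rule into_L)
      fix T assume T: "lc_admissible I E T"
      have "continuous_map (prod_topology ?L ?L) (prod_topology T T) (\<lambda>(f, g). (id f, id g))"
        unfolding continuous_map_prod_top using idL[OF T] continuous_map_id by blast
      moreover have "continuous_map (prod_topology T T) T (\<lambda>(f, g). \<lambda>x. f x + g x)"
        using T unfolding lc_admissible_def locally_convex_topology_def by (elim conjE)
      ultimately show "continuous_map (prod_topology ?L ?L) T (\<lambda>(f, g). \<lambda>x. f x + g x)"
        by (auto dest: continuous_map_compose simp: o_def case_prod_unfold)
    qed
    show "continuous_map (prod_topology euclidean ?L) ?L (\<lambda>(c, f). \<lambda>x. c * f x)"
    proof (rule into_L)
      fix T assume T: "lc_admissible I E T"
      have "continuous_map (prod_topology euclidean ?L) (prod_topology euclidean T)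
          (\<lambda>(c :: complex, f). (id c, id f))"
        unfolding continuous_map_prod_top using idL[OF T] continuous_map_id by blast
      moreover have "continuous_map (prod_topology euclidean T) T (\<lambda>(c, f). \<lambda>x. c * f x)"
        using T unfolding lc_admissible_def locally_convex_topology_def by (elim conjE)
      ultimately show "continuous_map (prod_topology euclidean ?L) T (\<lambda>(c, f). \<lambda>x. c * f x)"
        by (auto dest: continuous_map_compose simp: o_def case_prod_unfold)
    qed
    show "topspace ?L = (\<Union>i\<in>I. topspace (E i))" by (simp add: topL V_def)
    show "continuous_map (E i) ?L id" if "i \<in> I" for i
      using that by (intro into_L) (auto simp: lc_admissible_def)
    show "\<exists>W. openin ?L W \<and> (\<lambda>x. 0) \<in> W \<and> W \<subseteq> U \<and> ?cv W"
      if "openin ?L U \<and> (\<lambda>x. 0) \<in> U" for U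
      using that by (elim conjE) (rule convex_base)
  qed
qed


subsection \<open>Finiteness of the conjugates\<close>

lemma YF_conj_finite:
  fixes g :: "real ^ 'n::finite \<Rightarrow> real"
  assumes "\<And>K. \<exists>C. \<forall>y. K * norm y - C \<le> g y"
  shows "\<bar>YF_conj (\<lambda>y. ereal (g y)) x\<bar> \<noteq> \<infinity>"
proof -
  obtain C where C: "\<And>y. norm x * norm y - C \<le> g y" using assms by blast
  have "YF_conj (\<lambda>y. ereal (g y)) x \<le> ereal C"
    unfolding YF_conj_def
  proof (rule SUP_least)
    fix y
    have "x \<bullet> y \<le> norm x * norm y" by (rule norm_cauchy_schwarz)
    with C[of y] show "ereal (x \<bullet> y) - ereal (g y) \<le> ereal C" by simp
  qed
  moreover have "ereal (x \<bullet> 0 - g 0) \<le> YF_conj (\<lambda>y. ereal (g y)) x"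
    unfolding YF_conj_def by (rule SUP_upper2[of 0]) auto
  ultimately show ?thesis by auto
qed

lemma YF_conj_weight_finite:
  fixes h :: "real ^ 'n::finite \<Rightarrow> real"
  assumes "convex_on UNIV h"
    and lim: "filterlim (\<lambda>x. h x / norm x) at_top at_infinity"
  shows "\<bar>YF_conj (\<lambda>y. ereal (h y)) x\<bar> \<noteq> \<infinity>"
proof (rule YF_conj_finite)
  fix K :: real
  from lim have "eventually (\<lambda>x. K \<le> h x / norm x) at_infinity"
    by (simp add: filterlim_at_top)
  then obtain b where b: "\<And>x. b \<le> norm x \<Longrightarrow> K \<le> h x / norm x"
    unfolding eventually_at_infinity by blast
  have "continuous_on UNIV h" using assms(1) by (intro convex_on_continuous) auto
  then have "continuous_on (cball 0 \<bar>b\<bar>) (\<lambda>x. K * norm x - h x)"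
    by (intro continuous_intros) (auto intro: continuous_on_subset)
  then have "bounded ((\<lambda>x. K * norm x - h x) ` cball 0 \<bar>b\<bar>)"
    by (intro compact_imp_bounded compact_continuous_image) auto
  then obtain C where C: "\<And>x. x \<in> cball 0 \<bar>b\<bar> \<Longrightarrow> \<bar>K * norm x - h x\<bar> \<le> C"
    unfolding bounded_real by blast
  have "K * norm x - \<bar>C\<bar> \<le> h x" for x
  proof (cases "norm x \<le> \<bar>b\<bar>")
    case True
    then show ?thesis using C[of x] by auto
  next
    case False
    then have "norm x > 0" "b \<le> norm x" by linarith+
    then show ?thesis using b[of x] by (simp add: field_simps)
  qed
  then show "\<exists>C. \<forall>y. K * norm y - C \<le> h y" by blast
qed

lemma YF_conj_phi_finite:
  fixes h :: "real ^ 'n::finite \<Rightarrow> real"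
  assumes convex: "convex_on UNIV h"
    and lim: "filterlim (\<lambda>x. h x / norm x) at_top at_infinity"
    and upper: "\<And>M. M > 0 \<Longrightarrow> \<exists>A>0. \<forall>x. (\<forall>j. 0 \<le> x $ j) \<longrightarrow>
      h x \<le> (\<Sum>j | x $ j \<noteq> 0. x $ j * ln (x $ j / M)) + A"
  shows "\<bar>YF_conj (\<lambda>y. ereal (phi h y)) x\<bar> \<noteq> \<infinity>"
proof (rule YF_conj_finite)
  fix K :: real
  define M where "M = exp 1 * real CARD('n) * (\<bar>K\<bar> + 1)"
  have M: "M > 0" unfolding M_def by (intro mult_pos_pos) (auto simp: zero_less_card_finite)
  obtain A where A: "\<And>x. (\<forall>j. 0 \<le> x $ j) \<Longrightarrow>
      h x \<le> (\<Sum>j | x $ j \<noteq> 0. x $ j * ln (x $ j / M)) + A"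
    using upper[OF M] by blast
  have coord: "M * (1 + \<bar>y $ i\<bar>) / exp 1 - A \<le> phi h y" for y i
  proof -
    define u :: "real ^ 'n" where "u = (\<chi> j. ln (1 + \<bar>y $ j\<bar>))"
    define s where "s = M * (1 + \<bar>y $ i\<bar>) / exp 1"
    have s: "s > 0" using M by (auto simp: s_def intro!: divide_pos_pos mult_pos_pos)
    have "{j. axis i s $ j \<noteq> 0} = {i}" using s by (auto simp: axis_def)
    then have "h (axis i s) \<le> s * ln (s / M) + A"
      using A[of "axis i s"] s by (auto simp: axis_def)
    also have "ln (s / M) = ln (1 + \<bar>y $ i\<bar>) - 1"
      using M by (simp add: s_def ln_div)
    finally have 1: "s - A \<le> u \<bullet> axis i s - h (axis i s)"
      by (simp add: u_def inner_axis algebra_simps)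
    have "ereal (u \<bullet> axis i s - h (axis i s)) \<le> YF_conj (\<lambda>y. ereal (h y)) u"
      unfolding YF_conj_def by (rule SUP_upper2[of "axis i s"]) auto
    also have "\<dots> = ereal (phi h y)"
      unfolding phi_def conj_fun_def u_def
      using YF_conj_weight_finite[OF convex lim] by (simp add: ereal_real)
    finally show ?thesis using 1 by (simp add: s_def)
  qed
  have "K * norm y - A \<le> phi h y" for y
  proof -
    have "norm y \<le> (\<Sum>i\<in>UNIV. \<bar>y $ i\<bar>)" by (rule norm_le_l1_cart)
    then have "\<bar>K\<bar> * norm y \<le> (\<Sum>i\<in>UNIV. \<bar>K\<bar> * \<bar>y $ i\<bar>)"
      by (simp add: sum_distrib_left[symmetric] mult_left_mono)
    also have "\<dots> \<le> (\<Sum>i\<in>(UNIV::'n set). (phi h y + A) / real CARD('n))"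
    proof (rule sum_mono)
      fix i :: 'n
      have n: "real CARD('n) > 0" by (simp add: zero_less_card_finite)
      have "\<bar>K\<bar> * \<bar>y $ i\<bar> \<le> (\<bar>K\<bar> + 1) * (1 + \<bar>y $ i\<bar>)" by (intro mult_mono) auto
      then have "\<bar>K\<bar> * \<bar>y $ i\<bar> * real CARD('n) \<le> (\<bar>K\<bar> + 1) * (1 + \<bar>y $ i\<bar>) * real CARD('n)"
        using n by (intro mult_right_mono) auto
      also have "\<dots> = M * (1 + \<bar>y $ i\<bar>) / exp 1" by (simp add: M_def)
      also have "\<dots> \<le> phi h y + A" using coord[of y i] by linarith
      finally show "\<bar>K\<bar> * \<bar>y $ i\<bar> \<le> (phi h y + A) / real CARD('n)"
        using n by (simp add: pos_le_divide_eq)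
    qed
    also have "\<dots> = phi h y + A" by simp
    finally have "\<bar>K\<bar> * norm y \<le> phi h y + A" .
    moreover have "K * norm y \<le> \<bar>K\<bar> * norm y" by (intro mult_right_mono) auto
    ultimately show ?thesis by linarith
  qed
  then show "\<exists>C. \<forall>y. K * norm y - C \<le> phi h y" by blast
qed

end

theory Submission
  imports Defs
begin

text \<open>
  The norms of both scales apply different weights to the same derivatives, so it suffices to compare
  the weights, up to a shift of \<open>\<nu>\<close>; then each step of one scale embeds continuously into a step of
  the other one, and both inductive limits are taken over the same class of topologies.

  From \<open>GS\<close> to \<open>G\<close>: let \<open>v \<ge> 0\<close> be a subgradient of \<open>h\<^bsub>\<nu>+1\<^esub>\<close> at \<open>\<beta>\<close> and test \<open>\<phi>\<^sub>\<nu>\<^sup>*\<close> at the point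
  \<open>y = e\<^sup>v\<close>. Since \<open>ln (1 + e\<^sup>v) \<le> v + ln 2\<close>, condition 5) bounds \<open>\<phi>\<^sub>\<nu>(y)\<close> by
  \<open>\<langle>v,\<beta>\<rangle> - h\<^bsub>\<nu>+1\<^esub>(\<beta>) + \<gamma>\<close>, and \<open>t\<^sup>k \<le> k! e\<^sup>t\<close> with \<open>t = \<bar>x\<^sub>j\<bar> y\<^sub>j\<close>, \<open>k = \<beta>\<^sub>j\<close> finishes the estimate.

  From \<open>G\<close> to \<open>GS\<close>: for \<open>x, y \<ge> 0\<close> put \<open>z\<^sub>j = x\<^sub>j (1 + y\<^sub>j)\<close> and \<open>\<beta> = \<lfloor>z\<rfloor>\<close>. Then
  \<open>\<phi>(y) \<ge> \<langle>z, ln (1 + y)\<rangle> - h(z)\<close> and \<open>k! \<le> z\<^sup>k\<close> for \<open>k = \<lfloor>z\<rfloor>\<close> give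
  \<open>exp (\<langle>x,y\<rangle> - \<phi>(y)) \<le> exp (\<Sum>z\<^sub>j + h(z)) x\<^sup>\<beta> / \<beta>!\<close>, where conditions 5) and 6) allow to pass from
  \<open>\<Sum>z\<^sub>j + h\<^bsub>\<nu>+3\<^esub>(z)\<close> to \<open>h\<^sub>\<nu>(\<beta>)\<close>.
\<close>

section \<open>Comparison of locally convex topologies\<close>

lemma topspace_norms_topology:
  assumes "\<And>m. p m (\<lambda>x. 0) = 0"
  shows "topspace (norms_topology V p) = V"
proof -
  let ?S = "{{g \<in> V. p m (\<lambda>x. g x - f x) < ereal \<epsilon>} | f m \<epsilon>. f \<in> V \<and> \<epsilon> > 0}"
  have "f \<in> \<Union>?S" if "f \<in> V" for f
  proof
    show "{g \<in> V. p 0 (\<lambda>x. g x - f x) < ereal 1} \<in> ?S"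
      using that zero_less_one by blast
    show "f \<in> {g \<in> V. p 0 (\<lambda>x. g x - f x) < ereal 1}"
      using that by (simp add: assms)
  qed
  then have "\<Union>?S = V" by blast
  then show ?thesis by (simp add: norms_topology_def)
qed

text \<open>The subbasic sets are balls about arbitrary centres, so a \<open>p\<close>-ball about
  each point of a \<open>q\<close>-ball has to be fitted inside it. The triangle inequality is asked
  only on \<open>W\<close>, because differentiation is additive only on differentiable
  functions.\<close>

lemma continuous_map_norms_topology_id:
  assumes sub: "V \<subseteq> W" and C: "C > 0"
    and le: "\<And>m f. q m f \<le> ereal C * p m f"
    and p0: "\<And>m. p m (\<lambda>x. 0) = 0" and q0: "\<And>m. q m (\<lambda>x. 0) = 0"
    and triangle: "\<And>m f g k. f \<in> W \<Longrightarrow> g \<in> W \<Longrightarrow> k \<in> W \<Longrightarrow>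
      q m (\<lambda>x. f x - k x) \<le> q m (\<lambda>x. f x - g x) + q m (\<lambda>x. g x - k x)"
  shows "continuous_map (norms_topology V p) (norms_topology W q) id"
proof -
  let ?S = "{{g \<in> W. q m (\<lambda>x. g x - f x) < ereal \<epsilon>} | f m \<epsilon>. f \<in> W \<and> \<epsilon> > 0}"
  have union: "\<Union>?S = W"
    using topspace_norms_topology[of q W, OF q0] by (simp add: norms_topology_def)
  have "continuous_map (norms_topology V p) (topology_generated_by ?S) id"
  proof (rule continuous_on_generated_topo)
    show "id ` topspace (norms_topology V p) \<subseteq> \<Union>?S"
      unfolding union topspace_norms_topology[of p V, OF p0] using sub by simp
  next
    fix U assume "U \<in> ?S"
    then obtain f m \<epsilon> where U: "U = {g \<in> W. q m (\<lambda>x. g x - f x) < ereal \<epsilon>}"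
      and f: "f \<in> W" and "\<epsilon> > 0" by blast
    show "openin (norms_topology V p) (id -` U \<inter> topspace (norms_topology V p))"
      unfolding topspace_norms_topology[of p V, OF p0]
    proof (subst openin_subopen, intro ballI)
      fix g assume "g \<in> id -` U \<inter> V"
      then have g: "g \<in> V" "g \<in> W" "q m (\<lambda>x. g x - f x) < ereal \<epsilon>" by (auto simp: U)
      \<comment> \<open>A real \<open>s\<close> strictly between the distance and
        \<open>\<epsilon>\<close> leaves the slack \<open>\<epsilon> - s\<close>, which divided by
        \<open>C\<close> is the new radius.\<close>
      obtain s where s: "q m (\<lambda>x. g x - f x) < ereal s" "ereal s < ereal \<epsilon>"
        using ereal_dense2[OF g(3)] by blast
      define \<delta> where "\<delta> = (\<epsilon> - s) / C"
      have \<delta>: "\<delta> > 0" using s C by (simp add: \<delta>_def)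
      let ?B = "{k \<in> V. p m (\<lambda>x. k x - g x) < ereal \<delta>}"
      have "openin (norms_topology V p) ?B"
        unfolding norms_topology_def
        by (rule topology_generated_by_Basis) (use g \<delta> in blast)
      moreover have "g \<in> ?B" using g \<delta> by (simp add: p0)
      moreover have "k \<in> id -` U \<inter> V" if k: "k \<in> ?B" for k
      proof -
        have "k \<in> V" "k \<in> W" using k sub by auto
        have "q m (\<lambda>x. k x - g x) \<le> ereal C * p m (\<lambda>x. k x - g x)" by (rule le)
        also have "\<dots> \<le> ereal C * ereal \<delta>"
          using k C by (intro ereal_mult_left_mono) auto
        also have "\<dots> = ereal (\<epsilon> - s)" using C by (simp add: \<delta>_def)
        finally have 1: "q m (\<lambda>x. k x - g x) \<le> ereal (\<epsilon> - s)" .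
        have "q m (\<lambda>x. k x - f x) \<le> q m (\<lambda>x. k x - g x) + q m (\<lambda>x. g x - f x)"
          using \<open>k \<in> W\<close> g f by (intro triangle)
        also have "\<dots> \<le> ereal (\<epsilon> - s) + q m (\<lambda>x. g x - f x)" using 1 by (intro add_right_mono)
        also have "\<dots> < ereal (\<epsilon> - s) + ereal s" using s(1) by (intro ereal_less_add) auto
        finally show ?thesis using \<open>k \<in> V\<close> \<open>k \<in> W\<close> by (simp add: U)
      qed
      ultimately show "\<exists>T. openin (norms_topology V p) T \<and> g \<in> T \<and> T \<subseteq> id -` U \<inter> V" by blast
    qed
  qed
  then show ?thesis by (simp add: norms_topology_def)
qed

lemma lc_admissible_transfer:
  assumes "lc_admissible I E T"
    and "(\<Union>i\<in>I. topspace (E i)) = (\<Union>j\<in>J. topspace (F j))"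
    and cofinal: "\<And>j. j \<in> J \<Longrightarrow> \<exists>i\<in>I. continuous_map (F j) (E i) id"
  shows "lc_admissible J F T"
proof -
  have "continuous_map (F j) T id" if "j \<in> J" for j
  proof -
    from cofinal[OF that] obtain i where i: "i \<in> I" "continuous_map (F j) (E i) id" by blast
    then have "continuous_map (E i) T id" using assms(1) by (simp add: lc_admissible_def)
    with i(2) have "continuous_map (F j) T (id \<circ> id)" by (rule continuous_map_compose)
    then show ?thesis by simp
  qed
  then show ?thesis using assms(1,2) by (simp add: lc_admissible_def)
qed

lemma UN_topspace_subset:
  assumes "\<And>i. i \<in> I \<Longrightarrow> \<exists>j\<in>J. continuous_map (E i) (F j) id"
  shows "(\<Union>i\<in>I. topspace (E i)) \<subseteq> (\<Union>j\<in>J. topspace (F j))"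
proof (rule UN_least)
  fix i assume "i \<in> I"
  with assms obtain j where j: "j \<in> J" "continuous_map (E i) (F j) id" by blast
  then have "topspace (E i) \<subseteq> topspace (F j)" by (auto simp: continuous_map_def)
  with j(1) show "topspace (E i) \<subseteq> (\<Union>j\<in>J. topspace (F j))" by blast
qed

text \<open>A limit topology depends on its family only through the union of the carriers and the
  class of admissible topologies. Mutual continuous inclusions make both agree, since every
  inclusion into an admissible topology factors through the other family.\<close>

lemma lc_inductive_limit_eqI:
  assumes "\<And>i. i \<in> I \<Longrightarrow> \<exists>j\<in>J. continuous_map (E i) (F j) id"
    and "\<And>j. j \<in> J \<Longrightarrow> \<exists>i\<in>I. continuous_map (F j) (E i) id"
  shows "(\<Union>i\<in>I. topspace (E i)) = (\<Union>j\<in>J. topspace (F j))"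
    and "lc_inductive_limit I E = lc_inductive_limit J F"
proof -
  show *: "(\<Union>i\<in>I. topspace (E i)) = (\<Union>j\<in>J. topspace (F j))"
    by (intro equalityI UN_topspace_subset assms)
  have "lc_admissible I E T \<longleftrightarrow> lc_admissible J F T" for T
    using lc_admissible_transfer[OF _ * assms(2)] lc_admissible_transfer[OF _ *[symmetric] assms(1)]
    by (rule iffI)
  then show "lc_inductive_limit I E = lc_inductive_limit J F"
    by (simp add: lc_inductive_limit_def)
qed


section \<open>Linearity of the partial derivatives\<close>

lemma Cm_Suc_subset: "Cm (Suc m) \<subseteq> Cm m"
  by (induction m) auto

lemma Cm_antimono: "m \<le> k \<Longrightarrow> Cm k \<subseteq> Cm m"
  by (rule lift_Suc_antimono_le[of Cm, OF Cm_Suc_subset])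

text \<open>Existence of the derivatives is essential: \<open>vector_derivative\<close> has an
  unspecified value where there is none.\<close>

lemma partial_deriv_diff:
  assumes "has_partial_derivs f" "has_partial_derivs g"
  shows "partial_deriv j (\<lambda>x. f x - g x) = (\<lambda>x. partial_deriv j f x - partial_deriv j g x)"
  using assms by (auto simp: partial_deriv_def has_partial_derivs_def intro!: ext vector_derivative_diff_at)

lemma partial_deriv_zero: "partial_deriv j (\<lambda>x. 0) = (\<lambda>x. 0)"
  by (simp add: partial_deriv_def fun_eq_iff)

lemma partial_deriv_funpow_Cm: "f \<in> Cm (m + k) \<Longrightarrow> (partial_deriv j ^^ k) f \<in> Cm m"
proof (induction k arbitrary: m)
  case (Suc k)
  then show ?case using Suc.IH[of "Suc m"] by simp
qed simp

lemma partial_deriv_funpow_diff: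
  "f \<in> Cm k \<Longrightarrow> g \<in> Cm k \<Longrightarrow>
    (partial_deriv j ^^ k) (\<lambda>x. f x - g x) =
    (\<lambda>x. (partial_deriv j ^^ k) f x - (partial_deriv j ^^ k) g x)"
proof (induction k)
  case (Suc k)
  then have "f \<in> Cm k" "g \<in> Cm k" using Cm_Suc_subset by blast+
  \<comment> \<open>Of the \<open>Suc k\<close> available derivatives \<open>k\<close> are used up,
    which leaves a function in \<open>Cm 1\<close>.\<close>
  moreover have "has_partial_derivs ((partial_deriv j ^^ k) f)" "has_partial_derivs ((partial_deriv j ^^ k) g)"
    using partial_deriv_funpow_Cm[of _ 1 k j] Suc.prems by auto
  ultimately show ?case using Suc.IH by (simp add: partial_deriv_diff)
qed simp

text \<open>The spare order \<open>m\<close> drives the induction: \<open>foldr\<close>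
  differentiates along the tail first, and the head still needs \<open>\<alpha> j\<close> orders
  afterwards.\<close>

lemma foldr_partial_deriv_Cm:
  "f \<in> Cm (m + (\<Sum>j\<leftarrow>js. \<alpha> j)) \<Longrightarrow> foldr (\<lambda>j. partial_deriv j ^^ \<alpha> j) js f \<in> Cm m"
  by (induction js arbitrary: m) (auto simp: add.assoc[symmetric] intro!: partial_deriv_funpow_Cm)

lemma foldr_partial_deriv_diff:
  "f \<in> Cm (\<Sum>j\<leftarrow>js. \<alpha> j) \<Longrightarrow> g \<in> Cm (\<Sum>j\<leftarrow>js. \<alpha> j) \<Longrightarrow>
    foldr (\<lambda>j. partial_deriv j ^^ \<alpha> j) js (\<lambda>x. f x - g x) =
    (\<lambda>x. foldr (\<lambda>j. partial_deriv j ^^ \<alpha> j) js f x - foldr (\<lambda>j. partial_deriv j ^^ \<alpha> j) js g x)"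
proof (induction js)
  case (Cons i js)
  let ?D = "foldr (\<lambda>j. partial_deriv j ^^ \<alpha> j) js"
  have "?D u \<in> Cm (\<alpha> i)" if "u \<in> Cm (\<Sum>j\<leftarrow>i # js. \<alpha> j)" for u
    using that by (intro foldr_partial_deriv_Cm) simp
  moreover have "u \<in> Cm (\<Sum>j\<leftarrow>js. \<alpha> j)" if "u \<in> Cm (\<Sum>j\<leftarrow>i # js. \<alpha> j)" for u
    using that Cm_antimono[of "\<Sum>j\<leftarrow>js. \<alpha> j" "\<Sum>j\<leftarrow>i # js. \<alpha> j"] by auto
  ultimately have "(partial_deriv i ^^ \<alpha> i) (\<lambda>x. ?D f x - ?D g x) =
      (\<lambda>x. (partial_deriv i ^^ \<alpha> i) (?D f) x - (partial_deriv i ^^ \<alpha> i) (?D g) x)"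
    and "?D (\<lambda>x. f x - g x) = (\<lambda>x. ?D f x - ?D g x)"
    using Cons by (auto intro!: partial_deriv_funpow_diff)
  then show ?case by simp
qed simp

lemma mi_deriv_diff:
  assumes "f \<in> Cm m" "g \<in> Cm m" "mi_abs \<alpha> \<le> m"
  shows "mi_deriv \<alpha> (\<lambda>x. f x - g x) = (\<lambda>x. mi_deriv \<alpha> f x - mi_deriv \<alpha> g x)"
proof -
  have "(\<Sum>j\<leftarrow>coords. \<alpha> j) = mi_abs \<alpha>"
    by (simp add: mi_abs_def sum_list_distinct_conv_sum_set coords)
  then show ?thesis
    unfolding mi_deriv_def using assms Cm_antimono[OF assms(3)]
    by (intro foldr_partial_deriv_diff) auto
qed

lemma mi_deriv_zero: "mi_deriv \<alpha> (\<lambda>x. 0) = (\<lambda>x. 0)"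
proof -
  have "(partial_deriv j ^^ k) (\<lambda>x. 0) = (\<lambda>x. 0)" for j :: 'a and k
    by (induction k) (auto simp: partial_deriv_zero)
  then have "foldr (\<lambda>j. partial_deriv j ^^ \<alpha> j) js (\<lambda>x. 0) = (\<lambda>x. 0)" for js
    by (induction js) auto
  then show ?thesis by (simp add: mi_deriv_def)
qed


section \<open>The norms\<close>

lemma mi_fact_pos: "mi_fact \<beta> > 0"
  by (simp add: mi_fact_def prod_pos)

lemma G_norm_upper:
  "mi_abs \<alpha> \<le> m \<Longrightarrow> ereal (cmod (complex_of_real (mi_power x \<beta>) * mi_deriv \<alpha> f x)
    / (mi_fact \<beta> * exp (- h (mi_vec \<beta>)))) \<le> G_norm h m f"
  unfolding G_norm_def by (rule SUP_upper2[of "(x, \<beta>, \<alpha>)"]) auto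

lemma G_norm_least:
  "(\<And>x \<beta> \<alpha>. mi_abs \<alpha> \<le> m \<Longrightarrow> ereal (cmod (complex_of_real (mi_power x \<beta>) * mi_deriv \<alpha> f x)
    / (mi_fact \<beta> * exp (- h (mi_vec \<beta>)))) \<le> B) \<Longrightarrow> G_norm h m f \<le> B"
  unfolding G_norm_def by (rule SUP_least) auto

lemma GS_norm_upper:
  "mi_abs \<alpha> \<le> m \<Longrightarrow> ereal (cmod (mi_deriv \<alpha> f x) / exp (- M x)) \<le> GS_norm M m f"
  unfolding GS_norm_def by (rule SUP_upper2[of "(x, \<alpha>)"]) auto

lemma GS_norm_least:
  "(\<And>x \<alpha>. mi_abs \<alpha> \<le> m \<Longrightarrow> ereal (cmod (mi_deriv \<alpha> f x) / exp (- M x)) \<le> B) \<Longrightarrow>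
    GS_norm M m f \<le> B"
  unfolding GS_norm_def by (rule SUP_least) auto

lemma mi_abs_zero: "mi_abs (\<lambda>j. 0) = 0"
  by (simp add: mi_abs_def)

lemma G_norm_nonneg: "0 \<le> G_norm h m f"
  by (rule order_trans[OF _ G_norm_upper[of "\<lambda>j. 0" m 0 "\<lambda>j. 0"]])
    (simp_all add: mi_abs_zero less_imp_le[OF mi_fact_pos])

lemma GS_norm_nonneg: "0 \<le> GS_norm M m f"
  by (rule order_trans[OF _ GS_norm_upper[of "\<lambda>j. 0" m f 0]]) (simp_all add: mi_abs_zero)

lemma G_norm_zero: "G_norm h m (\<lambda>x. 0) = 0"
  by (rule antisym[OF G_norm_least G_norm_nonneg]) (simp add: mi_deriv_zero)

lemma GS_norm_zero: "GS_norm M m (\<lambda>x. 0) = 0"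
  by (rule antisym[OF GS_norm_least GS_norm_nonneg]) (simp add: mi_deriv_zero)

lemma cmod_mi_deriv_triangle:
  assumes "f \<in> Cm m" "g \<in> Cm m" "k \<in> Cm m" "mi_abs \<alpha> \<le> m"
  shows "cmod (mi_deriv \<alpha> (\<lambda>x. f x - k x) x) \<le>
    cmod (mi_deriv \<alpha> (\<lambda>x. f x - g x) x) + cmod (mi_deriv \<alpha> (\<lambda>x. g x - k x) x)"
  using assms norm_triangle_ineq[of "mi_deriv \<alpha> f x - mi_deriv \<alpha> g x" "mi_deriv \<alpha> g x - mi_deriv \<alpha> k x"]
  by (simp add: mi_deriv_diff)

lemma G_norm_triangle:
  assumes "f \<in> Cm m" "g \<in> Cm m" "k \<in> Cm m"
  shows "G_norm h m (\<lambda>x. f x - k x) \<le> G_norm h m (\<lambda>x. f x - g x) + G_norm h m (\<lambda>x. g x - k x)"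
proof (rule G_norm_least)
  fix x :: "real ^ 'a" and \<beta> \<alpha> :: "'a \<Rightarrow> nat" assume \<alpha>: "mi_abs \<alpha> \<le> m"
  let ?t = "\<lambda>u. cmod (complex_of_real (mi_power x \<beta>) * mi_deriv \<alpha> u x) / (mi_fact \<beta> * exp (- h (mi_vec \<beta>)))"
  have "?t (\<lambda>x. f x - k x) \<le> ?t (\<lambda>x. f x - g x) + ?t (\<lambda>x. g x - k x)"
    using cmod_mi_deriv_triangle[OF assms \<alpha>, of x] mi_fact_pos[of \<beta>]
    by (simp add: norm_mult add_divide_distrib[symmetric] distrib_left[symmetric] divide_right_mono mult_left_mono)
  then have "ereal (?t (\<lambda>x. f x - k x)) \<le> ereal (?t (\<lambda>x. f x - g x)) + ereal (?t (\<lambda>x. g x - k x))"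
    by simp
  also have "\<dots> \<le> G_norm h m (\<lambda>x. f x - g x) + G_norm h m (\<lambda>x. g x - k x)"
    using \<alpha> by (intro add_mono G_norm_upper)
  finally show "ereal (?t (\<lambda>x. f x - k x)) \<le> \<dots>" .
qed

lemma GS_norm_triangle:
  assumes "f \<in> Cm m" "g \<in> Cm m" "k \<in> Cm m"
  shows "GS_norm M m (\<lambda>x. f x - k x) \<le> GS_norm M m (\<lambda>x. f x - g x) + GS_norm M m (\<lambda>x. g x - k x)"
proof (rule GS_norm_least)
  fix x :: "real ^ 'a" and \<alpha> :: "'a \<Rightarrow> nat" assume \<alpha>: "mi_abs \<alpha> \<le> m"
  let ?t = "\<lambda>u. cmod (mi_deriv \<alpha> u x) / exp (- M x)"
  have "?t (\<lambda>x. f x - k x) \<le> ?t (\<lambda>x. f x - g x) + ?t (\<lambda>x. g x - k x)"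
    using cmod_mi_deriv_triangle[OF assms \<alpha>, of x]
    by (simp add: add_divide_distrib[symmetric] divide_right_mono)
  then have "ereal (?t (\<lambda>x. f x - k x)) \<le> ereal (?t (\<lambda>x. f x - g x)) + ereal (?t (\<lambda>x. g x - k x))"
    by simp
  also have "\<dots> \<le> GS_norm M m (\<lambda>x. f x - g x) + GS_norm M m (\<lambda>x. g x - k x)"
    using \<alpha> by (intro add_mono GS_norm_upper)
  finally show "ereal (?t (\<lambda>x. f x - k x)) \<le> \<dots>" .
qed

section \<open>Inclusions between steps of the two scales, reduced to pointwise estimates\<close>

lemma topspace_G_top: "topspace (G_top h) = G_space h"
  unfolding G_top_def by (rule topspace_norms_topology) (rule G_norm_zero)

lemma topspace_GS_top: "topspace (GS_top M) = GS_space M"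
  unfolding GS_top_def by (rule topspace_norms_topology) (rule GS_norm_zero)

lemma continuous_map_G_GS:
  assumes C: "C > 0" and le: "\<And>m f. GS_norm M m f \<le> ereal C * G_norm h m f"
  shows "continuous_map (G_top h) (GS_top M) id"
  unfolding G_top_def GS_top_def
proof (rule continuous_map_norms_topology_id[where p = "G_norm h" and q = "GS_norm M",
      OF _ C le G_norm_zero GS_norm_zero])
  have "GS_norm M m f < \<infinity>" if "G_norm h m f < \<infinity>" for m f
    using le[of m f] that G_norm_nonneg[of h m f]
    by (cases "G_norm h m f"; cases "GS_norm M m f") auto
  then show "G_space h \<subseteq> GS_space M"
    by (auto simp: G_space_def GS_space_def G_m_def GS_m_def)
  show "GS_norm M m (\<lambda>x. f x - k x) \<le> GS_norm M m (\<lambda>x. f x - g x) + GS_norm M m (\<lambda>x. g x - k x)"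
    if "f \<in> GS_space M" "g \<in> GS_space M" "k \<in> GS_space M" for m f g k
    using that by (intro GS_norm_triangle) (auto simp: GS_space_def GS_m_def)
qed

lemma continuous_map_GS_G:
  assumes C: "C > 0" and le: "\<And>m f. G_norm h m f \<le> ereal C * GS_norm M m f"
  shows "continuous_map (GS_top M) (G_top h) id"
  unfolding G_top_def GS_top_def
proof (rule continuous_map_norms_topology_id[where p = "GS_norm M" and q = "G_norm h",
      OF _ C le GS_norm_zero G_norm_zero])
  have "G_norm h m f < \<infinity>" if "GS_norm M m f < \<infinity>" for m f
    using le[of m f] that GS_norm_nonneg[of M m f]
    by (cases "GS_norm M m f"; cases "G_norm h m f") auto
  then show "GS_space M \<subseteq> G_space h"
    by (auto simp: G_space_def GS_space_def G_m_def GS_m_def)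
  show "G_norm h m (\<lambda>x. f x - k x) \<le> G_norm h m (\<lambda>x. f x - g x) + G_norm h m (\<lambda>x. g x - k x)"
    if "f \<in> G_space h" "g \<in> G_space h" "k \<in> G_space h" for m f g k
    using that by (intro G_norm_triangle) (auto simp: G_space_def G_m_def)
qed

text \<open>Here \<open>d\<close> stands for the modulus of a derivative at \<open>x\<close> and
  \<open>A\<close> for the \<open>G\<close>-norm. The inner premise ranges over all
  \<open>\<beta>\<close>, so that the multi-index may be chosen depending on the point.\<close>

lemma GS_norm_le_G_norm:
  assumes C: "C > 0"
    and bound: "\<And>x d A. d \<ge> 0 \<Longrightarrow>
      (\<And>\<beta>. \<bar>mi_power x \<beta>\<bar> * d \<le> A * (mi_fact \<beta> * exp (- h (mi_vec \<beta>)))) \<Longrightarrow> d \<le> C * A * exp (- M x)"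
  shows "GS_norm M m f \<le> ereal C * G_norm h m f"
proof (cases "G_norm h m f")
  case (real A)
  show ?thesis
  proof (rule GS_norm_least)
    fix x :: "real ^ 'a" and \<alpha> :: "'a \<Rightarrow> nat" assume \<alpha>: "mi_abs \<alpha> \<le> m"
    have "cmod (mi_deriv \<alpha> f x) \<le> C * A * exp (- M x)"
    proof (rule bound)
      show "\<bar>mi_power x \<beta>\<bar> * cmod (mi_deriv \<alpha> f x) \<le> A * (mi_fact \<beta> * exp (- h (mi_vec \<beta>)))" for \<beta>
        using G_norm_upper[OF \<alpha>, of x \<beta> f h] mi_fact_pos[of \<beta>]
        by (simp add: real norm_mult pos_divide_le_eq)
    qed simp
    then show "ereal (cmod (mi_deriv \<alpha> f x) / exp (- M x)) \<le> ereal C * G_norm h m f"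
      by (simp add: real pos_divide_le_eq)
  qed
next
  case PInf
  then show ?thesis using C by simp
next
  case MInf
  then show ?thesis using G_norm_nonneg[of h m f] by simp
qed

lemma G_norm_le_GS_norm:
  assumes C: "C > 0"
    and bound: "\<And>x \<beta>. \<bar>mi_power x \<beta>\<bar> * exp (- M x) \<le> C * (mi_fact \<beta> * exp (- h (mi_vec \<beta>)))"
  shows "G_norm h m f \<le> ereal C * GS_norm M m f"
proof (cases "GS_norm M m f")
  case (real A)
  have A: "0 \<le> A" using GS_norm_nonneg[of M m f] by (simp add: real)
  show ?thesis
  proof (rule G_norm_least)
    fix x :: "real ^ 'a" and \<beta> \<alpha> :: "'a \<Rightarrow> nat" assume \<alpha>: "mi_abs \<alpha> \<le> m"
    have "cmod (mi_deriv \<alpha> f x) \<le> A * exp (- M x)"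
      using GS_norm_upper[OF \<alpha>, of f x M] by (simp add: real pos_divide_le_eq)
    then have "\<bar>mi_power x \<beta>\<bar> * cmod (mi_deriv \<alpha> f x) \<le> \<bar>mi_power x \<beta>\<bar> * (A * exp (- M x))"
      by (intro mult_left_mono) auto
    also have "\<dots> \<le> A * (C * (mi_fact \<beta> * exp (- h (mi_vec \<beta>))))"
      using mult_left_mono[OF bound[of x \<beta>] A] by (simp add: ac_simps)
    finally show "ereal (cmod (complex_of_real (mi_power x \<beta>) * mi_deriv \<alpha> f x)
        / (mi_fact \<beta> * exp (- h (mi_vec \<beta>)))) \<le> ereal C * GS_norm M m f"
      using mi_fact_pos[of \<beta>] by (simp add: real norm_mult pos_divide_le_eq ac_simps)
  qed
next
  case PInf
  then show ?thesis using C by simp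
next
  case MInf
  then show ?thesis using GS_norm_nonneg[of M m f] by simp
qed


section \<open>Conjugates of the weights\<close>

lemma conj_fun_upper:
  assumes "\<bar>YF_conj (\<lambda>y. ereal (g y)) x\<bar> \<noteq> \<infinity>"
  shows "x \<bullet> y - g y \<le> conj_fun g x"
proof -
  have "ereal (x \<bullet> y - g y) \<le> YF_conj (\<lambda>y. ereal (g y)) x"
    unfolding YF_conj_def by (rule SUP_upper2[of y]) auto
  also have "\<dots> = ereal (conj_fun g x)" using assms by (simp add: conj_fun_def ereal_real)
  finally show ?thesis by simp
qed

text \<open>No finiteness is assumed: the bound \<open>c\<close> excludes plus infinity and the test
  point 0 excludes minus infinity.\<close>

lemma conj_fun_least:
  assumes "\<And>y. x \<bullet> y - g y \<le> c"
  shows "conj_fun g x \<le> c"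
proof -
  have "YF_conj (\<lambda>y. ereal (g y)) x \<le> ereal c"
    unfolding YF_conj_def using assms by (intro SUP_least) simp
  moreover have "ereal (x \<bullet> 0 - g 0) \<le> YF_conj (\<lambda>y. ereal (g y)) x"
    unfolding YF_conj_def by (rule SUP_upper2[of 0]) auto
  ultimately show ?thesis
    unfolding conj_fun_def by (cases "YF_conj (\<lambda>y. ereal (g y)) x") auto
qed

text \<open>A hyperplane with normal \<open>(p, q)\<close> separates \<open>(b, f b)\<close> from
  the strict epigraph; once \<open>q > 0\<close> is known, \<open>- p / q\<close> is a
  subgradient.\<close>

lemma convex_on_subgradient:
  fixes f :: "'a::euclidean_space \<Rightarrow> real"
  assumes "convex_on UNIV f"
  shows "\<exists>v. \<forall>z. f b + v \<bullet> (z - b) \<le> f z"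
proof -
  let ?T = "{(z, t). f z < t}"
  have "convex ?T"
  proof (rule convexI, clarsimp)
    fix x s y t and u v :: real
    assume a: "f x < s" "f y < t" "0 \<le> u" "0 \<le> v" "u + v = 1"
    have "f (u *\<^sub>R x + v *\<^sub>R y) \<le> u * f x + v * f y"
      using assms a by (auto simp: convex_on_def)
    also have "\<dots> < u * s + v * t"
    proof (cases "u = 0")
      case False
      then show ?thesis using a by (intro add_less_le_mono mult_strict_left_mono mult_left_mono) auto
    qed (use a in auto)
    finally show "f (u *\<^sub>R x + v *\<^sub>R y) < u * s + v * t" .
  qed
  moreover have "?T \<noteq> {}" using gt_ex[of "f b"] by auto
  moreover have "{(b, f b)} \<inter> ?T = {}" by simp
  ultimately have "\<exists>a c. a \<noteq> 0 \<and> (\<forall>y\<in>{(b, f b)}. a \<bullet> y \<le> c) \<and> (\<forall>y\<in>?T. c \<le> a \<bullet> y)"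
    by (intro separating_hyperplane_sets) simp_all
  then obtain a c where ac: "a \<noteq> 0" "a \<bullet> (b, f b) \<le> c" "\<And>y. y \<in> ?T \<Longrightarrow> c \<le> a \<bullet> y"
    by blast
  obtain p q where a: "a = (p, q)" by (cases a)
  have sep: "p \<bullet> b + q * f b \<le> p \<bullet> z + q * t" if "f z < t" for z t
    using ac(2) ac(3)[of "(z, t)"] that by (simp add: a)
  have "q \<ge> 0" using sep[of b "f b + 1"] by (simp add: algebra_simps)
  \<comment> \<open>A vertical hyperplane is impossible because \<open>f\<close> is finite
    everywhere: the point \<open>b - p\<close> lies on its wrong side unless
    \<open>p = 0\<close>.\<close>
  moreover have "q \<noteq> 0"
  proof
    assume "q = 0"
    then have "p \<bullet> p \<le> 0" using sep[of "b - p" "f (b - p) + 1"] by (simp add: inner_diff_right)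
    then have "p = 0" by (metis inner_gt_zero_iff not_le)
    then show False using \<open>q = 0\<close> ac(1) by (simp add: a zero_prod_def)
  qed
  ultimately have q: "q > 0" by simp
  have "f b + (- (1 / q) *\<^sub>R p) \<bullet> (z - b) \<le> f z" for z
  \<comment> \<open>The epigraph is strict, so \<open>sep\<close> applies only at heights
    \<open>f z + e\<close> with \<open>e > 0\<close>.\<close>
  proof (rule field_le_epsilon)
    fix e :: real assume "e > 0"
    then show "f b + (- (1 / q) *\<^sub>R p) \<bullet> (z - b) \<le> f z + e"
      using sep[of z "f z + e"] q by (simp add: inner_diff_right field_simps)
  qed
  then show ?thesis by blast
qed

text \<open>A single term of the exponential series is at most its sum.\<close>

lemma power_le_fact_mult_exp:
  fixes t :: real
  assumes "t \<ge> 0"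
  shows "t ^ k \<le> fact k * exp t"
proof -
  have "(\<Sum>n\<in>{k}. t ^ n /\<^sub>R fact n) \<le> (\<Sum>n. t ^ n /\<^sub>R fact n)"
    using assms by (intro sum_le_suminf summable_exp_generic) auto
  then show ?thesis by (simp add: exp_def field_simps)
qed

text \<open>Convexity and conditions 1) to 4) concern one function; 5) and 6) link consecutive
  members of the family and stay outside.\<close>

locale weight =
  fixes h :: "real ^ 'n::finite \<Rightarrow> real"
  assumes convex: "convex_on UNIV h"
    and even: "h x = h (\<chi> j. \<bar>x $ j\<bar>)"
    and mono_coord: "(\<forall>i. 0 \<le> x $ i) \<Longrightarrow> x $ j \<le> t \<Longrightarrow> h x \<le> h (\<chi> i. if i = j then t else x $ i)"
    and superlinear: "filterlim (\<lambda>x. h x / norm x) at_top at_infinity"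
    and upper: "M > 0 \<Longrightarrow> \<exists>A>0. \<forall>x. (\<forall>j. 0 \<le> x $ j) \<longrightarrow>
      h x \<le> (\<Sum>j | x $ j \<noteq> 0. x $ j * ln (x $ j / M)) + A"
begin

lemma mono:
  assumes "\<And>i. 0 \<le> x $ i" "\<And>i. x $ i \<le> y $ i"
  shows "h x \<le> h y"
proof -
  \<comment> \<open>The coordinates in \<open>S\<close> are raised one at a time.\<close>
  have "h x \<le> h (\<chi> i. if i \<in> S then y $ i else x $ i)" for S
    using finite[of S]
  proof (induction rule: finite_induct)
    case (insert j S)
    let ?w = "\<chi> i. if i \<in> S then y $ i else x $ i"
    have "h ?w \<le> h (\<chi> i. if i = j then y $ j else ?w $ i)"
      using assms insert.hyps by (intro mono_coord) (auto intro: order_trans)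
    also have "(\<chi> i. if i = j then y $ j else ?w $ i) = (\<chi> i. if i \<in> insert j S then y $ i else x $ i)"
      by (auto simp: vec_eq_iff)
    finally show ?case using insert.IH by simp
  qed simp
  from this[of UNIV] show ?thesis by simp
qed

lemma phi_upper: "(\<chi> j. ln (1 + \<bar>y $ j\<bar>)) \<bullet> z - h z \<le> phi h y"
  unfolding phi_def by (intro conj_fun_upper YF_conj_weight_finite convex superlinear)

lemma conj_phi_upper: "x \<bullet> y - phi h y \<le> conj_fun (phi h) x"
  by (intro conj_fun_upper YF_conj_phi_finite convex superlinear upper)

text \<open>Negative entries of a subgradient at \<open>b\<close> can only occur where \<open>b\<close> vanishes, and there they
  can be replaced by \<open>0\<close>.\<close>

lemma nonneg_subgradient:
  assumes b: "\<And>j. 0 \<le> b $ j"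
  shows "\<exists>v. (\<forall>j. 0 \<le> v $ j) \<and> (\<forall>z. h b + v \<bullet> (z - b) \<le> h z)"
proof -
  obtain v where v: "\<And>z. h b + v \<bullet> (z - b) \<le> h z"
    using convex_on_subgradient[OF convex] by blast
  have b0: "b $ j = 0" if "v $ j < 0" for j
  proof -
    \<comment> \<open>Deleting the coordinate \<open>j\<close> cannot increase \<open>h\<close>, so
      the subgradient inequality at \<open>?w\<close> forces
      \<open>v $ j * b $ j \<ge> 0\<close>.\<close>
    let ?w = "\<chi> i. if i = j then 0 else b $ i"
    have "v \<bullet> (?w - b) = (\<Sum>i\<in>UNIV. if i = j then - (v $ j * b $ j) else 0)"
      unfolding inner_vec_def by (intro sum.cong) auto
    also have "\<dots> = - (v $ j * b $ j)" by simp
    finally have "- (v $ j * b $ j) \<le> h ?w - h b" using v[of ?w] by linarith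
    also have "h ?w \<le> h b" by (rule mono) (use b in auto)
    finally have "0 \<le> v $ j * b $ j" by simp
    then show ?thesis using that b[of j] by (simp add: zero_le_mult_iff)
  qed
  define v' where "v' = (\<chi> j. max 0 (v $ j))"
  have "h b + v' \<bullet> (z - b) \<le> h z" for z
  proof -
    \<comment> \<open>Where \<open>v\<close> is negative, \<open>v'\<close> and \<open>b\<close>
      vanish, so that coordinate contributes 0 on both sides; elsewhere the absolute value only
      increases the product. Monotonicity and evenness give \<open>h z' \<le> h z\<close>.\<close>
    define z' where "z' = (\<chi> j. if v $ j < 0 then 0 else \<bar>z $ j\<bar>)"
    have "v' \<bullet> (z - b) \<le> v \<bullet> (z' - b)"
      unfolding inner_vec_def by (rule sum_mono) (auto simp: v'_def z'_def b0 max_def intro!: mult_left_mono)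
    then have "h b + v' \<bullet> (z - b) \<le> h z'" using v[of z'] by linarith
    also have "\<dots> \<le> h (\<chi> j. \<bar>z $ j\<bar>)" by (rule mono) (auto simp: z'_def)
    also have "\<dots> = h z" by (rule even[symmetric])
    finally show ?thesis .
  qed
  moreover have "\<forall>j. 0 \<le> v' $ j" by (simp add: v'_def)
  ultimately show ?thesis by blast
qed

end

section \<open>Weight estimate for embedding \<open>GS\<close> steps into \<open>G\<close>
  steps\<close>

lemma mi_power_mult_exp_conj_phi_le:
  assumes h: "weight h" and k: "weight k"
    and gap: "\<And>x. (\<forall>j. 0 \<le> x $ j) \<Longrightarrow> ln 2 * (\<Sum>j\<in>UNIV. x $ j) - \<gamma> \<le> h x - k x"
  shows "\<bar>mi_power x \<beta>\<bar> * exp (- conj_fun (phi h) x) \<le> exp \<gamma> * (mi_fact \<beta> * exp (- k (mi_vec \<beta>)))"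
proof -
  let ?b = "mi_vec \<beta>"
  obtain v where v0: "\<And>j. 0 \<le> v $ j" and v: "\<And>z. k ?b + v \<bullet> (z - ?b) \<le> k z"
    using weight.nonneg_subgradient[OF k, of ?b] by (auto simp: mi_vec_def)
  \<comment> \<open>The signs turn \<open>x \<bullet> y\<close> into the sum of
    \<open>\<bar>x $ j\<bar> * exp (v $ j)\<close> and do not affect \<open>phi h y\<close>.\<close>
  define y where "y = (\<chi> j. (if x $ j < 0 then - 1 else 1) * exp (v $ j))"
  have "phi h y \<le> \<gamma> + v \<bullet> ?b - k ?b"
    unfolding phi_def
  proof (rule conj_fun_least)
    fix z :: "real ^ 'a"
    define u where "u = (\<chi> j. ln (1 + \<bar>y $ j\<bar>))"
    \<comment> \<open>Condition 5) holds only on the nonnegative orthant; replacing \<open>z\<close>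
      by \<open>a\<close> keeps \<open>h\<close> and does not decrease the product with
      \<open>u \<ge> 0\<close>.\<close>
    define a where "a = (\<chi> j. \<bar>z $ j\<bar>)"
    have u: "0 \<le> u $ j" "u $ j \<le> v $ j + ln 2" for j
    proof -
      show "0 \<le> u $ j" by (simp add: u_def)
      have "u $ j = ln (1 + exp (v $ j))" by (simp add: u_def y_def abs_mult)
      \<comment> \<open>This uses \<open>v $ j \<ge> 0\<close>, that is
        \<open>1 \<le> exp (v $ j)\<close>.\<close>
      also have "\<dots> \<le> ln (2 * exp (v $ j))" using v0[of j] by (subst ln_le_cancel_iff) (auto simp: add_pos_pos)
      also have "\<dots> = v $ j + ln 2" by (simp add: ln_mult)
      finally show "u $ j \<le> v $ j + ln 2" .
    qed
    have "u \<bullet> z \<le> (\<Sum>j\<in>UNIV. (v $ j + ln 2) * a $ j)"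
      unfolding inner_vec_def
    proof (rule sum_mono)
      fix j
      have "u $ j * z $ j \<le> u $ j * a $ j" using u(1)[of j] by (intro mult_left_mono) (auto simp: a_def)
      also have "\<dots> \<le> (v $ j + ln 2) * a $ j" using u(2)[of j] by (intro mult_right_mono) (auto simp: a_def)
      finally show "u $ j \<bullet> z $ j \<le> (v $ j + ln 2) * a $ j" by simp
    qed
    also have "\<dots> = v \<bullet> a + ln 2 * (\<Sum>j\<in>UNIV. a $ j)"
      by (simp add: inner_vec_def distrib_right sum.distrib sum_distrib_left)
    finally have "u \<bullet> z \<le> v \<bullet> a + ln 2 * (\<Sum>j\<in>UNIV. a $ j)" .
    moreover have "h z = h a" unfolding a_def by (rule weight.even[OF h])
    moreover have "ln 2 * (\<Sum>j\<in>UNIV. a $ j) - \<gamma> \<le> h a - k a" by (rule gap) (simp add: a_def)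
    moreover have "k ?b + v \<bullet> a - v \<bullet> ?b \<le> k a" using v[of a] by (simp add: inner_diff_right)
    ultimately show "u \<bullet> z - h z \<le> \<gamma> + v \<bullet> ?b - k ?b" by linarith
  qed
  with weight.conj_phi_upper[OF h, of x y]
  have conj: "x \<bullet> y + k ?b - \<gamma> - v \<bullet> ?b \<le> conj_fun (phi h) x" by linarith
  have "\<bar>mi_power x \<beta>\<bar> * exp (v \<bullet> ?b) = (\<Prod>j\<in>UNIV. (\<bar>x $ j\<bar> * exp (v $ j)) ^ \<beta> j)"
    by (simp add: mi_power_def abs_prod power_abs inner_vec_def mi_vec_def exp_sum prod.distrib[symmetric]
        power_mult_distrib exp_of_nat2_mult)
  also have "\<dots> \<le> (\<Prod>j\<in>UNIV. fact (\<beta> j) * exp (\<bar>x $ j\<bar> * exp (v $ j)))"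
    by (intro prod_mono) (auto intro!: power_le_fact_mult_exp)
  also have "\<dots> = mi_fact \<beta> * exp (\<Sum>j\<in>UNIV. \<bar>x $ j\<bar> * exp (v $ j))"
    by (simp add: mi_fact_def prod.distrib exp_sum)
  also have "(\<Sum>j\<in>UNIV. \<bar>x $ j\<bar> * exp (v $ j)) = x \<bullet> y"
    unfolding inner_vec_def by (intro sum.cong) (auto simp: y_def)
  finally have *: "\<bar>mi_power x \<beta>\<bar> * exp (v \<bullet> ?b) \<le> mi_fact \<beta> * exp (x \<bullet> y)" .
  have "\<bar>mi_power x \<beta>\<bar> * exp (- conj_fun (phi h) x) \<le>
      \<bar>mi_power x \<beta>\<bar> * exp (v \<bullet> ?b + (\<gamma> - k ?b - x \<bullet> y))"
    using conj by (intro mult_left_mono) auto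
  also have "\<dots> = \<bar>mi_power x \<beta>\<bar> * exp (v \<bullet> ?b) * exp (\<gamma> - k ?b - x \<bullet> y)"
    by (simp only: exp_add mult.assoc)
  also have "\<dots> \<le> mi_fact \<beta> * exp (x \<bullet> y) * exp (\<gamma> - k ?b - x \<bullet> y)"
    using * by (intro mult_right_mono) auto
  also have "\<dots> = exp \<gamma> * (mi_fact \<beta> * exp (- k ?b))"
    by (simp add: exp_diff exp_minus exp_add field_simps)
  finally show ?thesis .
qed

section \<open>Weight estimate for embedding \<open>G\<close> steps into \<open>GS\<close>
  steps\<close>

text \<open>Since \<open>ln (1 + t) \<ge> 0\<close>, lowering the factor \<open>z\<close> to its
  floor \<open>k\<close> increases the left side. The power of \<open>1 + t\<close> that remains is
  traded for a factorial through \<open>k! \<le> k^k \<le> z^k = a^k (1 + t)^k\<close>.\<close>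

lemma exp_mult_diff_ln_le:
  fixes a t :: real
  assumes "0 \<le> a" "0 \<le> t"
  defines "z \<equiv> a * (1 + t)"
  defines "k \<equiv> nat \<lfloor>z\<rfloor>"
  shows "exp (a * t - z * ln (1 + t)) \<le> exp z * a ^ k / fact k"
proof -
  have z: "0 \<le> z" using assms by simp
  then have k: "real k \<le> z" by (simp add: k_def)
  have "fact k \<le> real k ^ k" using fact_le_power[of k, where 'a = real] by simp
  also have "\<dots> \<le> z ^ k" using k by (intro power_mono) auto
  also have "\<dots> = a ^ k * (1 + t) ^ k" by (simp add: z_def power_mult_distrib)
  finally have "1 / (1 + t) ^ k \<le> a ^ k / fact k" using assms by (simp add: field_simps)
  have "real k * ln (1 + t) \<le> z * ln (1 + t)" using k assms by (intro mult_right_mono) auto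
  moreover have "a * t \<le> z" using assms by (simp add: z_def algebra_simps)
  ultimately have "exp (a * t - z * ln (1 + t)) \<le> exp (z - real k * ln (1 + t))" by simp
  also have "\<dots> = exp z * (1 / (1 + t) ^ k)"
    using assms(2) by (simp add: exp_diff exp_of_nat_mult)
  also have "\<dots> \<le> exp z * (a ^ k / fact k)"
    using \<open>1 / (1 + t) ^ k \<le> a ^ k / fact k\<close> by (intro mult_left_mono) auto
  finally show ?thesis by simp
qed

text \<open>The bound \<open>key\<close> is uniform in \<open>y\<close>, so taking logarithms and
  the supremum over \<open>y\<close> yields the conjugate. The multi-index used depends on
  \<open>y\<close>, hence \<open>bound\<close> is needed for all \<open>\<beta>\<close>.\<close>

lemma le_exp_conj_phi:
  assumes k: "weight k"
    and floor: "\<And>z. (\<forall>j. 0 \<le> z $ j) \<Longrightarrow>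
      k z + (\<Sum>j\<in>UNIV. z $ j) \<le> h (mi_vec (\<lambda>j. nat \<lfloor>z $ j\<rfloor>)) + c"
    and d: "d \<ge> 0"
    and bound: "\<And>\<beta>. \<bar>mi_power x \<beta>\<bar> * d \<le> A * (mi_fact \<beta> * exp (- h (mi_vec \<beta>)))"
  shows "d \<le> exp c * A * exp (- conj_fun (phi k) x)"
proof -
  have key: "d * exp (x \<bullet> y - phi k y) \<le> exp c * A" for y
  proof -
    text \<open>For nonnegative \<open>x\<close>, \<open>y\<close> with \<open>y\<close> maximizing \<open>x \<bullet> y - phi k y\<close>, this \<open>z\<close> is a subgradient of
      the conjugate of \<open>k\<close> at \<open>ln (1 + y)\<close>.\<close>
    define z where "z = (\<chi> j. \<bar>x $ j\<bar> * (1 + \<bar>y $ j\<bar>))"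
    define \<beta> where "\<beta> = (\<lambda>j. nat \<lfloor>z $ j\<rfloor>)"
    have z0: "\<forall>j. 0 \<le> z $ j" by (simp add: z_def)
    have "x \<bullet> y - phi k y \<le> x \<bullet> y - (\<chi> j. ln (1 + \<bar>y $ j\<bar>)) \<bullet> z + k z"
      using weight.phi_upper[OF k, of y z] by linarith
    also have "x \<bullet> y \<le> (\<Sum>j\<in>UNIV. \<bar>x $ j\<bar> * \<bar>y $ j\<bar>)"
      unfolding inner_vec_def by (rule sum_mono) (metis abs_ge_self abs_mult inner_real_def)
    finally have "x \<bullet> y - phi k y \<le>
        (\<Sum>j\<in>UNIV. \<bar>x $ j\<bar> * \<bar>y $ j\<bar> - z $ j * ln (1 + \<bar>y $ j\<bar>)) + k z"
      by (simp add: inner_vec_def sum_subtractf mult.commute)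
    then have "exp (x \<bullet> y - phi k y) \<le>
        (\<Prod>j\<in>UNIV. exp (\<bar>x $ j\<bar> * \<bar>y $ j\<bar> - z $ j * ln (1 + \<bar>y $ j\<bar>))) * exp (k z)"
      by (simp add: exp_sum[symmetric] exp_add[symmetric])
    also have "\<dots> \<le> (\<Prod>j\<in>UNIV. exp (z $ j) * \<bar>x $ j\<bar> ^ \<beta> j / fact (\<beta> j)) * exp (k z)"
      unfolding \<beta>_def z_def
      by (intro mult_right_mono prod_mono) (use exp_mult_diff_ln_le in auto)
    also have "\<dots> = \<bar>mi_power x \<beta>\<bar> / mi_fact \<beta> * exp (k z + (\<Sum>j\<in>UNIV. z $ j))"
      by (simp add: prod.distrib prod_dividef exp_add exp_sum mi_power_def mi_fact_def abs_prod power_abs)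
    also have "\<dots> \<le> \<bar>mi_power x \<beta>\<bar> / mi_fact \<beta> * exp (h (mi_vec \<beta>) + c)"
      using floor[OF z0] mi_fact_pos[of \<beta>] by (intro mult_left_mono) (auto simp: \<beta>_def)
    finally have "d * exp (x \<bullet> y - phi k y) \<le> d * (\<bar>mi_power x \<beta>\<bar> / mi_fact \<beta> * exp (h (mi_vec \<beta>) + c))"
      using d by (rule mult_left_mono)
    also have "\<dots> = (\<bar>mi_power x \<beta>\<bar> * d) * (exp (h (mi_vec \<beta>) + c) / mi_fact \<beta>)" by simp
    also have "\<dots> \<le> (A * (mi_fact \<beta> * exp (- h (mi_vec \<beta>)))) * (exp (h (mi_vec \<beta>) + c) / mi_fact \<beta>)"
      using mi_fact_pos[of \<beta>] by (intro mult_right_mono bound) auto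
    also have "\<dots> = exp c * A"
      using mi_fact_pos[of \<beta>] by (simp add: exp_add exp_minus field_simps)
    finally show ?thesis .
  qed
  show ?thesis
  \<comment> \<open>The logarithm of \<open>exp c * A / d\<close> requires \<open>d > 0\<close>; for
    \<open>d = 0\<close> only the sign of \<open>A\<close> matters, and \<open>key\<close> supplies
    it.\<close>
  proof (cases "d = 0")
    case True
    then have "0 \<le> exp c * A" using key[of 0] by simp
    then show ?thesis using True by simp
  next
    case False
    with d have d: "d > 0" by simp
    have A: "exp c * A > 0" using d key[of 0] by (smt (verit) exp_gt_zero mult_pos_pos)
    have "conj_fun (phi k) x \<le> ln (exp c * A / d)"
    proof (rule conj_fun_least)
      fix y
      have "exp (x \<bullet> y - phi k y) \<le> exp c * A / d" using key[of y] d by (simp add: field_simps)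
      then show "x \<bullet> y - phi k y \<le> ln (exp c * A / d)" using A d by (subst ln_ge_iff) auto
    qed
    then have "exp (conj_fun (phi k) x) \<le> exp c * A / d" using A d by (subst (asm) ln_ge_iff) auto
    then show ?thesis using d by (simp add: exp_minus field_simps)
  qed
qed

theorem theorem4:
  fixes h :: "nat \<Rightarrow> real ^ 'n::finite \<Rightarrow> real"
  assumes convex_h: "\<And>\<nu>. \<nu> \<ge> 1 \<Longrightarrow> convex_on UNIV (h \<nu>)"
    and h1: "\<And>\<nu> x. \<nu> \<ge> 1 \<Longrightarrow> h \<nu> x = h \<nu> (\<chi> j. \<bar>x $ j\<bar>)"
    and h2: "\<And>\<nu> x j t. \<nu> \<ge> 1 \<Longrightarrow> (\<forall>i. 0 \<le> x $ i) \<Longrightarrow> x $ j \<le> t \<Longrightarrow>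
      h \<nu> x \<le> h \<nu> (\<chi> i. if i = j then t else x $ i)"
    and h3: "\<And>\<nu>. \<nu> \<ge> 1 \<Longrightarrow> filterlim (\<lambda>x. h \<nu> x / norm x) at_top at_infinity"
    and h4: "\<And>\<nu> M. \<nu> \<ge> 1 \<Longrightarrow> M > 0 \<Longrightarrow> \<exists>A>0. \<forall>x. (\<forall>j. 0 \<le> x $ j) \<longrightarrow>
      h \<nu> x \<le> (\<Sum>j | x $ j \<noteq> 0. x $ j * ln (x $ j / M)) + A"
    and h5: "\<And>\<nu>. \<nu> \<ge> 1 \<Longrightarrow> \<exists>\<gamma>. \<forall>x. (\<forall>j. 0 \<le> x $ j) \<longrightarrow>
      h \<nu> x - h (\<nu> + 1) x \<ge> ln 2 * (\<Sum>j\<in>UNIV. x $ j) - \<gamma>"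
    and h6: "\<And>\<nu>. \<nu> \<ge> 1 \<Longrightarrow> \<exists>l. \<forall>x y. (\<forall>j. 0 \<le> x $ j) \<and> (\<forall>j. 0 \<le> y $ j) \<longrightarrow>
      h (\<nu> + 1) (x + y) \<le> h \<nu> x + h \<nu> y + l"
    and convex_phi: "\<And>\<nu>. \<nu> \<ge> 1 \<Longrightarrow> convex_on UNIV (phi (h \<nu>))"
  shows "G_lim h = GS_lim (\<lambda>\<nu>. conj_fun (phi (h \<nu>))) \<and>
         G_lim_top h = GS_lim_top (\<lambda>\<nu>. conj_fun (phi (h \<nu>)))"
proof -
  let ?M = "\<lambda>\<nu>. conj_fun (phi (h \<nu>))"
  have weight: "weight (h \<nu>)" if "\<nu> \<ge> 1" for \<nu>
    by unfold_locales (fact convex_h[OF that] h1[OF that] h2[OF that] h3[OF that] h4[OF that])+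
  \<comment> \<open>The shift by 3 spends one index on condition 6) and two on condition 5):
    absorbing the sum of the \<open>z $ j\<close> takes two gaps, as
    \<open>ln 2 < 1 \<le> 2 * ln 2\<close>.\<close>
  have G_GS: "continuous_map (G_top (h \<nu>)) (GS_top (?M (\<nu> + 3))) id" if \<nu>: "\<nu> \<ge> 1" for \<nu>
  proof -
    obtain \<gamma>1 where \<gamma>1: "\<And>x. (\<forall>j. 0 \<le> x $ j) \<Longrightarrow>
        h (\<nu> + 1) x - h (\<nu> + 2) x \<ge> ln 2 * (\<Sum>j\<in>UNIV. x $ j) - \<gamma>1"
      using h5[of "\<nu> + 1"] by (auto simp: numeral_eq_Suc)
    obtain \<gamma>2 where \<gamma>2: "\<And>x. (\<forall>j. 0 \<le> x $ j) \<Longrightarrow>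
        h (\<nu> + 2) x - h (\<nu> + 3) x \<ge> ln 2 * (\<Sum>j\<in>UNIV. x $ j) - \<gamma>2"
      using h5[of "\<nu> + 2"] by (auto simp: numeral_eq_Suc)
    obtain l where l: "\<And>x y. (\<forall>j. 0 \<le> x $ j) \<Longrightarrow> (\<forall>j. 0 \<le> y $ j) \<Longrightarrow>
        h (\<nu> + 1) (x + y) \<le> h \<nu> x + h \<nu> y + l"
      using h6[OF \<nu>] by blast
    \<comment> \<open>Here \<open>h \<nu> 1\<close>, the value at the all-ones vector, bounds
      \<open>h \<nu>\<close> at the fractional part of \<open>z\<close>.\<close>
    define c where "c = h \<nu> 1 + l + \<gamma>1 + \<gamma>2"
    have floor: "h (\<nu> + 3) z + (\<Sum>j\<in>UNIV. z $ j) \<le> h \<nu> (mi_vec (\<lambda>j. nat \<lfloor>z $ j\<rfloor>)) + c"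
      if z: "\<forall>j. 0 \<le> z $ j" for z
    proof -
      let ?w = "mi_vec (\<lambda>j. nat \<lfloor>z $ j\<rfloor>)"
      have w: "0 \<le> ?w $ j" "0 \<le> (z - ?w) $ j" "(z - ?w) $ j \<le> 1" for j
        using z by (simp_all add: mi_vec_def) linarith+
      have "h (\<nu> + 1) z \<le> h \<nu> ?w + h \<nu> (z - ?w) + l"
        using l[of ?w "z - ?w"] w by simp
      also have "h \<nu> (z - ?w) \<le> h \<nu> 1"
        by (rule weight.mono[OF weight[OF \<nu>]]) (use w in auto)
      finally have "h (\<nu> + 1) z \<le> h \<nu> ?w + h \<nu> 1 + l" by simp
      moreover have "(\<Sum>j\<in>UNIV. z $ j) \<le> 2 * ln 2 * (\<Sum>j\<in>UNIV. z $ j)"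
        using ln2_ge_two_thirds z mult_right_mono[of 1 "2 * ln 2" "\<Sum>j\<in>UNIV. z $ j"] by (simp add: sum_nonneg)
      ultimately show ?thesis using \<gamma>1[OF z] \<gamma>2[OF z] unfolding c_def by linarith
    qed
    show ?thesis
      by (rule continuous_map_G_GS[OF exp_gt_zero GS_norm_le_G_norm[OF exp_gt_zero]],
          rule le_exp_conj_phi[OF weight floor]) auto
  qed
  \<comment> \<open>One use of condition 5) suffices in this direction, so the index moves by
    1.\<close>
  have GS_G: "continuous_map (GS_top (?M \<nu>)) (G_top (h (\<nu> + 1))) id" if \<nu>: "\<nu> \<ge> 1" for \<nu>
  proof -
    obtain \<gamma> where "\<And>x. (\<forall>j. 0 \<le> x $ j) \<Longrightarrow>
        ln 2 * (\<Sum>j\<in>UNIV. x $ j) - \<gamma> \<le> h \<nu> x - h (\<nu> + 1) x"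
      using h5[OF \<nu>] by blast
    with \<nu> show ?thesis
      by (intro continuous_map_GS_G[OF exp_gt_zero G_norm_le_GS_norm[OF exp_gt_zero]]
          mi_power_mult_exp_conj_phi_le weight) auto
  qed
  have 1: "\<exists>j\<in>{1..}. continuous_map (G_top (h i)) (GS_top (?M j)) id" if "i \<in> {1..}" for i
    using G_GS[of i] that by (intro bexI[of _ "i + 3"]) auto
  have 2: "\<exists>i\<in>{1..}. continuous_map (GS_top (?M j)) (G_top (h i)) id" if "j \<in> {1..}" for j
    using GS_G[of j] that by (intro bexI[of _ "j + 1"]) auto
  show ?thesis
    \<comment> \<open>The unions of the carriers are \<open>G_lim\<close> and \<open>GS_lim\<close>,
      so the set equality comes out along with that of the topologies.\<close>
    using lc_inductive_limit_eqI[of "{1..}" "{1..}" "\<lambda>\<nu>. G_top (h \<nu>)" "\<lambda>\<nu>. GS_top (?M \<nu>)", OF 1 2]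
    by (simp add: topspace_G_top topspace_GS_top G_lim_def GS_lim_def G_lim_top_def GS_lim_top_def)
qed

end
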